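(* Let $r\ge 1$. The semistable cycles of rank $r$ and degree $0$ are precisely the cycles represented by sequences of length $r$ of the form $$(0,\dots,0,1,0,\dots,0,-1,0,\dots,0,1,\dots\dots,-1,\dots,0),$$ i.e. with entries in $\{-1,0,1\}$ whose nonzero entries (if any) alternate cyclically between $1$ and $-1$ (so there are equally many of each), with zero-blocks of arbitrary (possibly zero) lengths. If $r>1$, none of these cycles is both stable and aperiodic. If $r=1$, there is just one semistable cycle of rank $1$ and degree $0$, namely $(0)$, and it is stable.
   Context: A chain is a finite (nonempty) sequence of integers. A cycle is an equivalence class of chains under the equivalence generated by the cyclic shift $(a_1,\dots,a_r)\sim(a_2,\dots,a_r,a_1)$; a cycle is denoted by a representing sequence. A cycle is aperiodic if its sequence cannot be written as a concatenation of equal proper subsequences. A subchain of a cycle $(a_1,\dots,a_r)$ is a chain $(a_i,a_{i+1},\dots,a_{i+l})$ with $1\le i\le r$, $0\le l<r$, indices taken modulo $r$; it is proper if its length is less than $r$. For a chain $\mathbf b=(b_1,\dots,b_k)$: $\deg\mathbf b=\sum b_i-1$, rank $k$, slope $\mu(\mathbf b)=\deg\mathbf b/k$. For a cycle $\mathbf a=(a_1,\dots,a_r)$: $\deg\mathbf a=\sum a_i$, rank $r$, slope $\mu(\mathbf a)=\deg\mathbf a/r$. A cycle $\mathbf a$ is semistable if $\mu(\mathbf b)\le\mu(\mathbf a)$ for every subchain $\mathbf b$ of $\mathbf a$ (with $\mu(\mathbf b)$ the slope of a chain), and stable if moreover the inequality is strict for every proper subchain. *)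

theory Defs
  imports Complex_Main
begin

text \<open>A chain is a nonempty \<^typ>\<open>int list\<close>; nonemptiness is enforced in the partial
  equivalence relation by which cycles are formed.\<close>

type_synonym chain = "int list"

definition chain_degree :: "chain \<Rightarrow> int" where
  "chain_degree b = sum_list b - 1"

definition chain_slope :: "chain \<Rightarrow> rat" where
  "chain_slope b = of_int (chain_degree b) / of_nat (length b)"

definition shift_equiv :: "chain \<Rightarrow> chain \<Rightarrow> bool" where
  "shift_equiv a b \<longleftrightarrow> a \<noteq> [] \<and> b \<noteq> [] \<and> equivclp (\<lambda>u v. v = rotate1 u) a b"

lemma shift_equiv_sym: "shift_equiv a b \<Longrightarrow> shift_equiv b a"
  unfolding shift_equiv_def by (auto intro: equivclp_sym)

lemma shift_equiv_imp_rotate: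
  assumes "shift_equiv a b"
  shows "\<exists>n. b = rotate n a"
proof -
  have "equivclp (\<lambda>u v. v = rotate1 u) a b"
    using assms by (simp add: shift_equiv_def)
  then show ?thesis
  proof (induction rule: equivclp_induct)
    case base
    have "a = rotate 0 a" by simp
    then show ?case ..
  next
    case (step y z)
    from step.IH obtain n where n: "y = rotate n a" ..
    from step.hyps(2) show ?case
    proof
      assume "z = rotate1 y"
      then have "z = rotate (Suc n) a" by (simp add: n)
      then show ?thesis ..
    next
      assume y: "y = rotate1 z"
      have "z = rotate (length z - 1) y"
      proof (cases "z = []")
        case False
        then have "length z - 1 + 1 = length z"
          by (simp add: Suc_leI)
        then have "rotate (length z - 1) (rotate 1 z) = rotate (length z) z"
          by (simp only: rotate_rotate)
        then show ?thesis by (simp add: y)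
      qed (simp add: y)
      then have "z = rotate (length z - 1 + n) a" by (simp add: n rotate_rotate)
      then show ?thesis ..
    qed
  qed
qed

quotient_type cycle = "int list" / partial: shift_equiv
  morphisms rep_cycle cycle_of
proof (rule part_equivpI)
  show "\<exists>x. shift_equiv x x"
    by (rule exI[of _ "[0]"]) (simp add: shift_equiv_def)
  show "symp shift_equiv"
    by (simp add: sympI shift_equiv_sym)
  show "transp shift_equiv"
    by (rule transpI) (auto simp: shift_equiv_def intro: equivclp_trans)
qed

lift_definition cycle_degree :: "cycle \<Rightarrow> int" is sum_list
proof -
  fix a b assume "shift_equiv a b"
  then obtain n where b: "b = rotate n a" using shift_equiv_imp_rotate by blast
  have "sum_list (rotate1 c) = sum_list c" for c :: "int list"
    by (cases c) simp_all
  then have "sum_list (rotate n a) = sum_list a"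
    by (induction n) simp_all
  then show "sum_list a = sum_list b" by (simp add: b)
qed

lift_definition cycle_rank :: "cycle \<Rightarrow> nat" is length
  using shift_equiv_imp_rotate by fastforce

definition cycle_slope :: "cycle \<Rightarrow> rat" where
  "cycle_slope C = of_int (cycle_degree C) / of_nat (cycle_rank C)"

definition list_subchains :: "chain \<Rightarrow> chain set" where
  "list_subchains a =
     {map (\<lambda>j. a ! ((i + j) mod length a)) [0..<Suc l] | i l. i < length a \<and> l < length a}"

lemma list_subchains_shift:
  assumes "shift_equiv a b"
  shows "list_subchains b \<subseteq> list_subchains a"
proof
  fix c assume "c \<in> list_subchains b"
  then obtain i l where c: "c = map (\<lambda>j. b ! ((i + j) mod length b)) [0..<Suc l]"
    and il: "i < length b" "l < length b"
    unfolding list_subchains_def by blast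
  obtain n where b: "b = rotate n a" using shift_equiv_imp_rotate assms by blast
  have len: "length b = length a" by (simp add: b)
  have pos: "length a > 0" using il len by linarith
  have "b ! ((i + j) mod length b) = a ! (((n + i) mod length a + j) mod length a)" for j
  proof -
    have "(i + j) mod length a < length a" using pos by simp
    then have "b ! ((i + j) mod length b) = a ! ((n + (i + j) mod length a) mod length a)"
      unfolding len unfolding b by (rule nth_rotate)
    also have "(n + (i + j) mod length a) mod length a = ((n + i) mod length a + j) mod length a"
      by (simp only: mod_add_left_eq mod_add_right_eq add.assoc)
    finally show ?thesis .
  qed
  then have "c = map (\<lambda>j. a ! (((n + i) mod length a + j) mod length a)) [0..<Suc l]"
    unfolding c by simp
  moreover have "(n + i) mod length a < length a" using pos by simp
  moreover have "l < length a" using il len by simp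
  ultimately show "c \<in> list_subchains a"
    unfolding list_subchains_def mem_Collect_eq by (intro exI conjI)
qed

lift_definition subchains :: "cycle \<Rightarrow> chain set" is list_subchains
  by (intro equalityI list_subchains_shift) (auto intro: shift_equiv_sym)

definition semistable_cycle :: "cycle \<Rightarrow> bool" where
  "semistable_cycle C \<longleftrightarrow> (\<forall>b \<in> subchains C. chain_slope b \<le> cycle_slope C)"

definition stable_cycle :: "cycle \<Rightarrow> bool" where
  "stable_cycle C \<longleftrightarrow> semistable_cycle C \<and>
     (\<forall>b \<in> subchains C. length b < cycle_rank C \<longrightarrow> chain_slope b < cycle_slope C)"

definition list_periodic :: "chain \<Rightarrow> bool" where
  "list_periodic a \<longleftrightarrow> (\<exists>b n. length b < length a \<and> a = concat (replicate n b))"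

lemma list_periodic_rotate1: "list_periodic a \<Longrightarrow> list_periodic (rotate1 a)"
proof -
  assume "list_periodic a"
  then obtain b n where bn: "length b < length a" "a = concat (replicate n b)"
    unfolding list_periodic_def by blast
  have "b \<noteq> []" using bn by (metis concat_replicate_trivial less_irrefl)
  then obtain x c where b: "b = x # c" by (cases b) auto
  have *: "concat (replicate m (x # c)) @ [x] = x # concat (replicate m (c @ [x]))" for m
    by (induction m) auto
  obtain m where n: "n = Suc m" using bn by (cases n) auto
  have "rotate1 a = concat (replicate n (c @ [x]))"
    using *[of m] by (simp add: bn(2) b n)
  moreover have "length (c @ [x]) < length (rotate1 a)" using bn b by simp
  ultimately show ?thesis unfolding list_periodic_def by blast
qed

lemma list_periodic_shift:
  assumes "shift_equiv a b" "list_periodic a"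
  shows "list_periodic b"
proof -
  obtain n where b: "b = rotate n a" using shift_equiv_imp_rotate assms(1) by blast
  have "list_periodic (rotate n a)"
    by (induction n) (simp_all add: assms(2) list_periodic_rotate1)
  then show ?thesis by (simp add: b)
qed

lift_definition aperiodic :: "cycle \<Rightarrow> bool" is "\<lambda>a. \<not> list_periodic a"
  using list_periodic_shift shift_equiv_sym by blast

text \<open>Reading the index modulo the number of nonzero entries expresses cyclic alternation: the
  last nonzero entry is also opposite to the first one. In particular exactly one nonzero entry is
  impossible, and no nonzero entries is allowed.\<close>

definition cyclically_alternating :: "int list \<Rightarrow> bool" where
  "cyclically_alternating a \<longleftrightarrow> set a \<subseteq> {-1, 0, 1} \<and>
     (let b = filter (\<lambda>x. x \<noteq> 0) a
      in \<forall>i < length b. b ! (Suc i mod length b) = - (b ! i))"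

end

theory Submission
  imports Defs
begin

text \<open>Semistability in degree 0 says that every subchain has sum at most 1, that is, that the
  partial sums of the periodic continuation of the sequence differ pairwise by at most 1. So they
  take only two consecutive values, and a walk on two consecutive integers goes up and down
  alternately whenever it moves. An entry 1 is itself a subchain of slope 0, which destroys
  stability for \<open>r > 1\<close>; without such an entry the cycle is zero, hence periodic.\<close>

section \<open>Representatives of cycles, and semistability in degree 0\<close>

lemma cycle_of_cases:
  obtains a where "C = cycle_of a" "a \<noteq> []"
proof -
  have "Quotient3 shift_equiv cycle_of rep_cycle"
    by (rule Quotient3_cycle)
  then have "cycle_of (rep_cycle C) = C" "shift_equiv (rep_cycle C) (rep_cycle C)"
    by (simp_all add: Quotient3_abs_rep Quotient3_rep_reflp)
  then show thesis
    using that by (metis shift_equiv_def)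
qed

lemma shift_equiv_refl: "a \<noteq> [] \<Longrightarrow> shift_equiv a a"
  by (simp add: shift_equiv_def)

text \<open>The quotient is partial, so the lifted equations carry the premise
  \<open>shift_equiv a a\<close>; reflexivity reduces it to \<open>a \<noteq> []\<close>, which simp
  can discharge.\<close>

lemmas cycle_of_simps [simp] =
  cycle_rank.abs_eq [OF shift_equiv_refl] cycle_degree.abs_eq [OF shift_equiv_refl]
  subchains.abs_eq [OF shift_equiv_refl] aperiodic.abs_eq [OF shift_equiv_refl]

lemma length_list_subchain: "c \<in> list_subchains a \<Longrightarrow> 0 < length c"
  by (auto simp: list_subchains_def)

lemma chain_slope_nonpos_iff: "c \<noteq> [] \<Longrightarrow> chain_slope c \<le> 0 \<longleftrightarrow> sum_list c \<le> 1"
  by (simp add: chain_slope_def chain_degree_def divide_le_0_iff)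

lemma semistable_cycle_of_degree_0_iff:
  assumes "a \<noteq> []" "sum_list a = 0"
  shows "semistable_cycle (cycle_of a) \<longleftrightarrow> (\<forall>c\<in>list_subchains a. sum_list c \<le> 1)"
proof -
  have "cycle_slope (cycle_of a) = 0"
    using assms by (simp add: cycle_slope_def)
  then show ?thesis
    using assms length_list_subchain
    by (auto simp: semistable_cycle_def chain_slope_nonpos_iff)
qed

section \<open>Partial sums of the periodic continuation\<close>

definition periodic_sum :: "int list \<Rightarrow> nat \<Rightarrow> int" where
  "periodic_sum a n = (\<Sum>j<n. a ! (j mod length a))"

lemma periodic_sum_eq_sum_take:
  assumes "k \<le> length a"
  shows "periodic_sum a k = sum_list (take k a)"
  using assms by (auto simp: periodic_sum_def sum_list_sum_nth atLeast0LessThan intro!: sum.cong)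

text \<open>Subchains that wrap past the end of the list need no separate treatment: their sums are
  differences of partial sums as well.\<close>

lemma periodic_sum_diff:
  "(\<Sum>j<l. a ! ((i + j) mod length a)) = periodic_sum a (i + l) - periodic_sum a i"
  by (induction l) (simp_all add: periodic_sum_def)

lemma periodic_sum_add_length:
  assumes "sum_list a = 0"
  shows "periodic_sum a (n + length a) = periodic_sum a n"
proof (induction n)
  case 0
  show ?case using assms by (simp add: periodic_sum_eq_sum_take)
qed (simp_all add: periodic_sum_def)

lemma periodic_sum_mod_length:
  assumes "sum_list a = 0"
  shows "periodic_sum a (n mod length a) = periodic_sum a n"
proof -
  have "periodic_sum a (m + k * length a) = periodic_sum a m" for m k
  proof (induction k)
    case (Suc k)
    then show ?case
      using periodic_sum_add_length [OF assms, of "m + k * length a"]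
      by (simp add: algebra_simps)
  qed simp
  from this [of "n mod length a" "n div length a"] show ?thesis by simp
qed

lemma sum_list_map_upt_Suc: "sum_list (map f [0..<Suc l]) = (\<Sum>j<Suc l. f j :: int)"
  by (induction l) simp_all

lemma list_subchains_sum_iff:
  "(\<forall>c\<in>list_subchains a. sum_list c \<le> 1) \<longleftrightarrow>
    (\<forall>i<length a. \<forall>l<length a. periodic_sum a (i + Suc l) - periodic_sum a i \<le> 1)"
proof -
  have "(\<forall>c\<in>list_subchains a. sum_list c \<le> 1) \<longleftrightarrow> (\<forall>i<length a. \<forall>l<length a.
      sum_list (map (\<lambda>j. a ! ((i + j) mod length a)) [0..<Suc l]) \<le> 1)"
    unfolding list_subchains_def by blast
  then show ?thesis
    by (simp only: sum_list_map_upt_Suc periodic_sum_diff)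
qed

text \<open>In degree 0 the partial sums are periodic, and subchains realize their differences in
  both directions. Hence all values lie within distance 1 of each other, and \<open>s\<close> shifts
  them to 0 and 1.\<close>

lemma bounded_subchains_iff_two_levels:
  assumes "a \<noteq> []" "sum_list a = 0"
  shows "(\<forall>c\<in>list_subchains a. sum_list c \<le> 1) \<longleftrightarrow>
    (\<exists>s. \<forall>k\<le>length a. s + sum_list (take k a) \<in> {0, 1})" (is "_ \<longleftrightarrow> ?R")
proof -
  let ?r = "length a" and ?F = "periodic_sum a"
  have "(\<forall>c\<in>list_subchains a. sum_list c \<le> 1) \<longleftrightarrow> (\<forall>i j. ?F j - ?F i \<le> 1)"
    unfolding list_subchains_sum_iff
  proof (intro iffI allI)
    fix i j
    assume *: "\<forall>i<?r. \<forall>l<?r. ?F (i + Suc l) - ?F i \<le> 1"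
    define i' j' where "i' = i mod ?r" and "j' = j mod ?r"
    have less: "i' < ?r" "j' < ?r"
      using assms(1) by (simp_all add: i'_def j'_def)
    have "?F j' - ?F i' \<le> 1"
    proof (cases i' j' rule: linorder_cases)
      case less
      then show ?thesis
        using *[rule_format, of i' "j' - i' - 1"] \<open>i' < ?r\<close> \<open>j' < ?r\<close> by simp
    next
      case greater
      \<comment> \<open>The subchain starting at \<open>i'\<close> wraps around and stops at
        \<open>j' + ?r\<close>, where \<open>?F\<close> takes the same value as at
        \<open>j'\<close>.\<close>
      then have "i' + Suc (j' + ?r - i' - 1) = j' + ?r" "j' + ?r - i' - 1 < ?r"
        using less by linarith+
      then show ?thesis
        using *[rule_format, of i' "j' + ?r - i' - 1"] less
          periodic_sum_add_length [OF assms(2), of j'] by simp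
    qed simp
    then show "?F j - ?F i \<le> 1"
      by (simp add: i'_def j'_def periodic_sum_mod_length [OF assms(2)])
  qed blast
  also have "\<dots> \<longleftrightarrow> (\<exists>s. \<forall>k. s + ?F k \<in> {0, 1})"
  proof
    assume *: "\<forall>i j. ?F j - ?F i \<le> 1"
    have F0: "?F 0 = 0" by (simp add: periodic_sum_def)
    have bounds: "- 1 \<le> ?F k" "?F k \<le> 1" for k
      using *[rule_format, of 0 k] *[rule_format, of k 0] F0 by simp_all
    show "\<exists>s. \<forall>k. s + ?F k \<in> {0, 1}"
    \<comment> \<open>As \<open>?F 0 = 0\<close>, the values lie in {-1, 0} or in {0, 1};
      accordingly \<open>s\<close> is 1 if -1 is attained, and 0 otherwise.\<close>
    proof (cases "\<exists>m. ?F m = - 1")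
      case True
      then obtain m where "?F m = - 1" ..
      then have "1 + ?F k \<in> {0, 1}" for k
        using *[rule_format, of k m] bounds [of k] by auto
      then show ?thesis by blast
    next
      case False
      then have "0 + ?F k \<in> {0, 1}" for k
        using bounds [of k] by (smt (verit) insert_iff)
      then show ?thesis by blast
    qed
  next
    assume "\<exists>s. \<forall>k. s + ?F k \<in> {0, 1}"
    then obtain s where "\<And>k. s + ?F k \<in> {0, 1}" by blast
    then show "\<forall>i j. ?F j - ?F i \<le> 1"
      by (smt (verit) insert_iff empty_iff)
  qed
  also have "\<dots> \<longleftrightarrow> ?R"
  proof -
    have "(\<forall>k. s + ?F k \<in> {0, 1}) \<longleftrightarrow> (\<forall>k\<le>?r. s + ?F k \<in> {0, 1})" for s
      by (metis assms length_greater_0_conv less_imp_le mod_less_divisor periodic_sum_mod_length)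
    then show ?thesis by (simp add: periodic_sum_eq_sum_take)
  qed
  finally show ?thesis .
qed

section \<open>Walks on two levels and alternating signs\<close>

abbreviation nonzero_entries :: "int list \<Rightarrow> int list" where
  "nonzero_entries a \<equiv> filter (\<lambda>x. x \<noteq> 0) a"

text \<open>A walk at \<open>s \<in> {0, 1}\<close> that stays in \<open>{0, 1}\<close> must make \<open>1 - 2 * s\<close> its next nonzero
  step.\<close>

lemma two_levels_iff_alternating:
  "(\<forall>k\<le>length a. s + sum_list (take k a) \<in> {0, 1}) \<longleftrightarrow>
    s \<in> {0, 1} \<and> (\<forall>i<length (nonzero_entries a). nonzero_entries a ! i = (1 - 2 * s) * (- 1) ^ i)"
proof (induction a arbitrary: s)
  case Nil
  show ?case by simp
next
  case (Cons x xs)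
  have "(\<forall>k\<le>length (x # xs). s + sum_list (take k (x # xs)) \<in> {0, 1}) \<longleftrightarrow>
      s \<in> {0, 1} \<and> (\<forall>k\<le>length xs. (s + x) + sum_list (take k xs) \<in> {0, 1})"
    by (simp add: All_less_Suc2 add.assoc flip: less_Suc_eq_le)
  also have "\<dots> \<longleftrightarrow> s \<in> {0, 1} \<and> s + x \<in> {0, 1} \<and>
      (\<forall>i<length (nonzero_entries xs).
        nonzero_entries xs ! i = (1 - 2 * (s + x)) * (- 1) ^ i)"
    by (simp only: Cons.IH)
  also have "\<dots> \<longleftrightarrow> s \<in> {0, 1} \<and> (\<forall>i<length (nonzero_entries (x # xs)).
      nonzero_entries (x # xs) ! i = (1 - 2 * s) * (- 1) ^ i)"
  proof (cases "x = 0")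
    case False
    \<comment> \<open>A nonzero step leads from \<open>s\<close> to \<open>1 - s\<close>, which
      negates \<open>1 - 2 * s\<close>; this absorbs the shift of the exponent caused by the new
      head.\<close>
    have "s \<in> {0, 1} \<Longrightarrow> s + x \<in> {0, 1} \<longleftrightarrow> x = 1 - 2 * s"
      using False by auto
    then show ?thesis
      using False by (auto simp: All_less_Suc2)
  qed auto
  finally show ?case .
qed

lemma sum_list_nonzero_entries: "sum_list (nonzero_entries a) = sum_list a"
  by (induction a) simp_all

lemma sum_alternating: "(\<Sum>i<n. e * (- 1) ^ i) = (if even n then 0 else e :: int)"
  by (induction n) auto

text \<open>Neighbouring terms cancel, so only the parity of the length matters. This translates
  degree 0 into an even number of nonzero entries.\<close>

lemma sum_list_alternating_eq_0_iff:
  assumes "\<forall>i<length b. b ! i = e * (- 1) ^ i" "e \<noteq> (0 :: int)"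
  shows "sum_list b = 0 \<longleftrightarrow> even (length b)"
proof -
  have "sum_list b = (\<Sum>i<length b. e * (- 1) ^ i)"
    using assms(1) by (auto simp: sum_list_sum_nth atLeast0LessThan intro!: sum.cong)
  then show ?thesis
    using assms(2) by (simp add: sum_alternating)
qed

text \<open>The conditions at \<open>Suc i < length b\<close> give linear alternation from the sign
  of the first entry, encoded as \<open>1 - 2 * s\<close>; the remaining one, at the last index,
  amounts to even length.\<close>

lemma cyclic_sign_change_iff:
  assumes "set b \<subseteq> {- 1, 1 :: int}"
  shows "(\<forall>i<length b. b ! (Suc i mod length b) = - (b ! i)) \<longleftrightarrow>
    even (length b) \<and> (\<exists>s\<in>{0, 1}. \<forall>i<length b. b ! i = (1 - 2 * s) * (- 1) ^ i)"
    (is "?L \<longleftrightarrow> ?R")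
proof (cases "b = []")
  case False
  let ?n = "length b"
  have n: "0 < ?n" using False by simp
  have b0: "b ! 0 = 1 \<or> b ! 0 = - 1"
    using assms nth_mem [OF n] by auto
  show ?thesis
  proof
    assume L: ?L
    have alt: "b ! i = b ! 0 * (- 1) ^ i" if "i < ?n" for i
      using that
    proof (induction i)
      case (Suc i)
      have "b ! (Suc i mod ?n) = - (b ! i)"
        using L Suc.prems by (meson Suc_lessD)
      then show ?case
        using Suc by simp
    qed simp
    \<comment> \<open>This is the wrap-around instance; with linear alternation it forces
      \<open>(- 1) ^ (?n - 1) = - 1\<close>, because \<open>b ! 0\<close> is nonzero.\<close>
    have "b ! 0 = - (b ! (?n - 1))"
      using L [rule_format, of "?n - 1"] n by simp
    also have "b ! (?n - 1) = b ! 0 * (- 1) ^ (?n - 1)"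
      using n by (intro alt) simp
    finally have "even ?n"
      using b0 n by (cases ?n) (auto split: if_splits simp: minus_one_power_iff)
    moreover have "\<exists>s\<in>{0, 1}. b ! 0 = 1 - 2 * s"
      using b0 by auto
    ultimately show ?R
      using alt by metis
  next
    assume ?R
    then obtain s where even: "even ?n"
      and alt: "\<And>i. i < ?n \<Longrightarrow> b ! i = (1 - 2 * s) * (- 1) ^ i"
      by blast
    show ?L
    proof (intro allI impI)
      fix i assume i: "i < ?n"
      show "b ! (Suc i mod ?n) = - (b ! i)"
      proof (cases "Suc i = ?n")
        case True
        then have "odd i" using even by (metis even_Suc)
        then show ?thesis
          using True alt [OF i] alt [OF n] by simp
      next
        case False
        then show ?thesis
          using i alt [of "Suc i"] alt [OF i] by simp
      qed
    qed
  qed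
qed auto

lemma cyclically_alternating_iff:
  "cyclically_alternating a \<longleftrightarrow>
    sum_list a = 0 \<and> (\<exists>s. \<forall>k\<le>length a. s + sum_list (take k a) \<in> {0, 1})"
proof -
  let ?b = "nonzero_entries a"
  let ?alt = "\<lambda>s. \<forall>i<length ?b. ?b ! i = (1 - 2 * s) * (- 1) ^ i"
  \<comment> \<open>For the converse direction, the range of entries required by
    \<open>cyclic_sign_change_iff\<close> has to be recovered from the alternation itself.\<close>
  have entries: "set ?b \<subseteq> {- 1, 1}" if "s \<in> {0, 1}" "?alt s" for s
  proof
    fix x assume "x \<in> set ?b"
    then obtain i where "i < length ?b" "x = ?b ! i"
      by (metis in_set_conv_nth)
    then show "x \<in> {- 1, 1}"
      using that by (auto simp: minus_one_power_iff)
  qed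
  have even: "sum_list a = 0 \<longleftrightarrow> even (length ?b)" if "s \<in> {0, 1}" "?alt s" for s
    using sum_list_alternating_eq_0_iff [OF that(2)] that(1)
    by (auto simp: sum_list_nonzero_entries)
  have "set a \<subseteq> {- 1, 0, 1} \<longleftrightarrow> set ?b \<subseteq> {- 1, 1}"
    by auto
  then have "cyclically_alternating a \<longleftrightarrow>
      set ?b \<subseteq> {- 1, 1} \<and> even (length ?b) \<and> (\<exists>s\<in>{0, 1}. ?alt s)"
    unfolding cyclically_alternating_def Let_def using cyclic_sign_change_iff by blast
  also have "\<dots> \<longleftrightarrow> sum_list a = 0 \<and> (\<exists>s\<in>{0, 1}. ?alt s)"
    using entries even by blast
  finally show ?thesis
    by (simp only: two_levels_iff_alternating Bex_def)
qed

section \<open>Classification in degree 0, stability and periodicity\<close>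

lemma semistable_degree_0_iff_alternating:
  assumes "a \<noteq> []"
  shows "cycle_degree (cycle_of a) = 0 \<and> semistable_cycle (cycle_of a) \<longleftrightarrow>
    cyclically_alternating a"
  using assms
  \<comment> \<open>\<open>conj_cong\<close> makes degree 0 available while the semistability
    conjunct is rewritten.\<close>
  by (simp add: cyclically_alternating_iff semistable_cycle_of_degree_0_iff
      bounded_subchains_iff_two_levels cong: conj_cong)

lemma semistable_degree_0_eq_alternating:
  assumes "r \<ge> 1"
  shows "{C. cycle_rank C = r \<and> cycle_degree C = 0 \<and> semistable_cycle C}
    = {cycle_of a | a. length a = r \<and> cyclically_alternating a}" (is "?L = ?R")
proof (intro set_eqI iffI)
  fix C assume C: "C \<in> ?L"
  obtain a where "C = cycle_of a" "a \<noteq> []" by (rule cycle_of_cases)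
  then show "C \<in> ?R"
    using C semistable_degree_0_iff_alternating by auto
next
  fix C assume "C \<in> ?R"
  then obtain a where a: "C = cycle_of a" "length a = r" "cyclically_alternating a" by blast
  then have "a \<noteq> []" using assms by auto
  then show "C \<in> ?L"
    using a semistable_degree_0_iff_alternating by auto
qed

lemma singleton_in_list_subchains:
  assumes "x \<in> set a"
  shows "[x] \<in> list_subchains a"
proof -
  obtain i where "i < length a" "x = a ! i"
    using assms by (metis in_set_conv_nth)
  then have "[x] = map (\<lambda>j. a ! ((i + j) mod length a)) [0..<Suc 0]" "0 < length a"
    by auto
  then show ?thesis
    unfolding list_subchains_def mem_Collect_eq using \<open>i < length a\<close> by (intro exI conjI)
qed

lemma stable_degree_0_imp_periodic:
  assumes "cycle_rank C > 1" "cycle_degree C = 0" "stable_cycle C"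
  shows "\<not> aperiodic C"
proof -
  obtain a where a: "C = cycle_of a" "a \<noteq> []" by (rule cycle_of_cases)
  have "length a > 1" "sum_list a = 0"
    using assms a by simp_all
  have "x \<noteq> 1" if "x \<in> set a" for x
    using singleton_in_list_subchains [OF that] assms a
    by (auto simp: stable_cycle_def cycle_slope_def chain_slope_def chain_degree_def)
  moreover have "x \<le> 1" if "x \<in> set a" for x
    using singleton_in_list_subchains [OF that] assms a
    by (fastforce simp: stable_cycle_def semistable_cycle_of_degree_0_iff)
  ultimately have le: "x \<le> 0" if "x \<in> set a" for x
    using that by (smt (verit))
  \<comment> \<open>Negation makes the entries nonnegative, so that a vanishing sum forces each of
    them to vanish.\<close>
  have "sum_list (map uminus a) = 0"
    using \<open>sum_list a = 0\<close> uminus_sum_list_map [of id a] by simp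
  then have "\<forall>x\<in>set a. x = 0"
    using le sum_list_nonneg_eq_0_iff [of "map uminus a"] by fastforce
  then have "a = concat (replicate (length a) [0])"
    by (induction a) auto
  then have "list_periodic a"
    using \<open>length a > 1\<close> unfolding list_periodic_def
    by (intro exI [of _ "[0]"] exI [of _ "length a"]) simp
  then show ?thesis
    using a by simp
qed

lemma cyclically_alternating_singleton_iff: "cyclically_alternating [x] \<longleftrightarrow> x = 0"
  by (auto simp: cyclically_alternating_def)

text \<open>In rank 1 no subchain is proper, since subchains are nonempty; stability reduces to
  semistability.\<close>

lemma stable_cycle_zero: "stable_cycle (cycle_of [0])"
  using semistable_degree_0_iff_alternating [of "[0]"] length_list_subchain
  by (auto simp: stable_cycle_def cyclically_alternating_singleton_iff)

theorem proposition3p18: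
  fixes r :: nat
  assumes "r \<ge> 1"
  shows "{C. cycle_rank C = r \<and> cycle_degree C = 0 \<and> semistable_cycle C}
           = {cycle_of a | a. length a = r \<and> cyclically_alternating a}
    \<and> (r > 1 \<longrightarrow>
          \<not> (\<exists>C. cycle_rank C = r \<and> cycle_degree C = 0 \<and> semistable_cycle C
                \<and> stable_cycle C \<and> aperiodic C))
    \<and> (r = 1 \<longrightarrow>
          {C. cycle_rank C = r \<and> cycle_degree C = 0 \<and> semistable_cycle C} = {cycle_of [0]}
          \<and> stable_cycle (cycle_of [0]))"
proof -
  have "{cycle_of a | a. length a = 1 \<and> cyclically_alternating a} = {cycle_of [0]}"
    by (auto simp: length_Suc_conv cyclically_alternating_singleton_iff)
  then show ?thesis
    using semistable_degree_0_eq_alternating [OF assms] stable_degree_0_imp_periodic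
      stable_cycle_zero
    by auto
qed

end
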